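(* Let $(H;\langle\cdot,\cdot\rangle)$ be an inner product space over the real or complex number field $\mathbb{K}$, let $x_i\in H\setminus\{0\}$ for $i\in\{1,\dots,n\}$, and let $\rho\in(0,1)$ be such that $$\Big\|x_i-\frac{x_j}{\|x_j\|}\Big\|\le\rho\qquad\text{for }1\le i<j\le n.$$ Then $$\sqrt{1-\rho^2}\Big(\sum_{i=1}^n\|x_i\|\Big)^2+\big(1-\sqrt{1-\rho^2}\big)\sum_{i=1}^n\|x_i\|^2\le\Big\|\sum_{i=1}^n x_i\Big\|^2.$$ Equality holds in this last inequality if and only if $$\|x_i\|\,\|x_j\|=\frac1{\sqrt{1-\rho^2}}\operatorname{Re}\langle x_i,x_j\rangle$$ for all $i,j$ with $1\le i<j\le n$.
   Context: $n$ is a positive integer and $\|\cdot\|$ is the norm induced by the inner product. *)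

theory Defs
  imports "HOL-Analysis.Inner_Product"
begin

text \<open>The scalar field: a field carrying an identification, as a real algebra, with either
  \<open>\<real>\<close> or \<open>\<complex>\<close>. Real parts and conjugates of scalars are taken through this identification.\<close>

class real_or_complex_field = real_field +
  fixes to_complex :: "'a \<Rightarrow> complex"
  assumes to_complex_add: "to_complex (a + b) = to_complex a + to_complex b"
    and to_complex_mult: "to_complex (a * b) = to_complex a * to_complex b"
    and to_complex_of_real: "to_complex (scaleR r 1) = complex_of_real r"
    and inj_to_complex: "to_complex a = to_complex b \<Longrightarrow> a = b"
    and range_to_complex: "range to_complex = \<real> \<or> range to_complex = UNIV"

instantiation real :: real_or_complex_field
begin

definition to_complex_real :: "real \<Rightarrow> complex"
  where "to_complex_real = complex_of_real"

instance
  by standard (auto simp: to_complex_real_def Reals_def)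

end

instantiation complex :: real_or_complex_field
begin

definition to_complex_complex :: "complex \<Rightarrow> complex"
  where "to_complex_complex = (\<lambda>z. z)"

instance
  by standard (auto simp: to_complex_complex_def scaleR_conv_of_real)

end

locale inner_product_space = vector_space scale
  for scale :: "'k::real_or_complex_field \<Rightarrow> 'v::ab_group_add \<Rightarrow> 'v" +
  fixes ip :: "'v \<Rightarrow> 'v \<Rightarrow> 'k"
  assumes ip_conj_sym: "to_complex (ip x y) = cnj (to_complex (ip y x))"
    and ip_add_left: "ip (x + y) z = ip x z + ip y z"
    and ip_scale_left: "ip (scale a x) y = a * ip x y"
    and ip_nonneg: "0 \<le> Re (to_complex (ip x x))"
    and ip_definite: "ip x x = 0 \<Longrightarrow> x = 0"

definition ip_norm :: "('v \<Rightarrow> 'v \<Rightarrow> 'k::real_or_complex_field) \<Rightarrow> 'v \<Rightarrow> real"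
  where "ip_norm ip x = sqrt (Re (to_complex (ip x x)))"

text \<open>Over \<open>\<real>\<close>, the library's real inner product spaces are covered, with the same norm;
  over \<open>\<complex>\<close>, the simplest example is \<open>\<complex>\<close> itself.\<close>

lemma inner_product_space_inner:
  "inner_product_space (scaleR :: real \<Rightarrow> 'v::real_inner \<Rightarrow> 'v) inner"
  by unfold_locales
    (auto simp: to_complex_real_def inner_commute algebra_simps)

lemma ip_norm_inner: "ip_norm inner (x :: 'v::real_inner) = norm x"
  by (simp add: ip_norm_def to_complex_real_def norm_eq_sqrt_inner)

lemma inner_product_space_complex:
  "inner_product_space ((*) :: complex \<Rightarrow> complex \<Rightarrow> complex) (\<lambda>z w. z * cnj w)"
  by unfold_locales
    (auto simp: to_complex_complex_def algebra_simps)

lemma ip_norm_complex: "ip_norm (\<lambda>z w. z * cnj w) (z :: complex) = norm z"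
  by (simp add: ip_norm_def to_complex_complex_def cmod_def power2_eq_square)

end

theory Submission
  imports Defs
begin

text \<open>
  Write \<open>s = sqrt (1 - \<rho>\<^sup>2)\<close>. The theorem is a sum of inequalities over pairs. Squaring the hypothesis
  on a pair \<open>i < j\<close> and expanding gives \<open>\<parallel>x\<^sub>i\<parallel>\<^sup>2 + s\<^sup>2 \<le> 2 Re \<langle>x\<^sub>i, x\<^sub>j\<rangle> / \<parallel>x\<^sub>j\<parallel>\<close>, and since
  \<open>2 s \<parallel>x\<^sub>i\<parallel> \<le> \<parallel>x\<^sub>i\<parallel>\<^sup>2 + s\<^sup>2\<close> this becomes the reverse Schwarz inequality
  \<open>s \<parallel>x\<^sub>i\<parallel> \<parallel>x\<^sub>j\<parallel> \<le> Re \<langle>x\<^sub>i, x\<^sub>j\<rangle>\<close> (lemma \<open>reverse_Schwarz\<close>).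

  Now consider the symmetric matrix of defects \<open>Re \<langle>x\<^sub>i, x\<^sub>j\<rangle> - s \<parallel>x\<^sub>i\<parallel> \<parallel>x\<^sub>j\<parallel>\<close>. The sum of all its entries is
  \<open>\<parallel>\<Sum> x\<^sub>i\<parallel>\<^sup>2 - s (\<Sum> \<parallel>x\<^sub>i\<parallel>)\<^sup>2\<close>, and its diagonal sums to \<open>(1 - s) \<Sum> \<parallel>x\<^sub>i\<parallel>\<^sup>2\<close>. The right-hand side of
  the theorem therefore exceeds the left-hand side by exactly twice the sum of the defects above the
  diagonal (lemma \<open>sum_symmetric_square\<close>). All of these are nonnegative, which proves the inequality;
  their sum vanishes only if each of them does, which is the equality condition.
\<close>

lemma sum_symmetric_square:
  fixes f :: "nat \<Rightarrow> nat \<Rightarrow> 'a::comm_semiring_1"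
  assumes sym: "\<And>i j. f i j = f j i"
  shows "(\<Sum>i=1..n. \<Sum>j=1..n. f i j) = (\<Sum>i=1..n. f i i) + 2 * (\<Sum>j=1..n. \<Sum>i\<in>{1..<j}. f i j)"
proof (induction n)
  case 0
  then show ?case by simp
next
  case (Suc n)
  have "(\<Sum>j=1..n. f (Suc n) j) = (\<Sum>i=1..n. f i (Suc n))"
    by (rule sum.cong[OF refl], rule sym)
  moreover have "{1..<Suc n} = {1..n}" by auto
  ultimately show ?case
    using Suc.IH by (simp add: sum.distrib algebra_simps mult_2)
qed

lemma to_complex_of_real_scalar:
  "to_complex (of_real r :: 'k::real_or_complex_field) = complex_of_real r"
  by (simp add: of_real_def to_complex_of_real)

lemma to_complex_zero: "to_complex (0 :: 'k::real_or_complex_field) = 0"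
  using to_complex_of_real[of 0, where 'a = 'k] by simp

context inner_product_space
begin

text \<open>The real part of \<open>ip\<close> is a real inner product inducing the same norm. Norms of sums and
  differences depend on \<open>ip\<close> only through it, so the two scalar fields need no separate treatment.\<close>

definition re_ip :: "'v \<Rightarrow> 'v \<Rightarrow> real"
  where "re_ip x y = Re (to_complex (ip x y))"

lemma re_ip_sym: "re_ip x y = re_ip y x"
  unfolding re_ip_def by (subst ip_conj_sym) simp

lemma re_ip_add_left: "re_ip (x + y) z = re_ip x z + re_ip y z"
  by (simp add: re_ip_def ip_add_left to_complex_add)

lemma re_ip_add_right: "re_ip z (x + y) = re_ip z x + re_ip z y"
  by (metis re_ip_sym re_ip_add_left)

lemma re_ip_zero_left: "re_ip 0 z = 0"
  using re_ip_add_left[of 0 0 z] by simp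

lemma re_ip_diff_left: "re_ip (x - y) z = re_ip x z - re_ip y z"
  using re_ip_add_left[of "x - y" y z] by simp

lemma re_ip_diff_right: "re_ip z (x - y) = re_ip z x - re_ip z y"
  by (metis re_ip_sym re_ip_diff_left)

lemma re_ip_scale_left: "re_ip (scale (of_real r) x) y = r * re_ip x y"
  by (simp add: re_ip_def ip_scale_left to_complex_mult to_complex_of_real_scalar)

lemma re_ip_scale_right: "re_ip y (scale (of_real r) x) = r * re_ip y x"
  by (metis re_ip_sym re_ip_scale_left)

lemma re_ip_sum_left: "re_ip (sum x A) z = (\<Sum>i\<in>A. re_ip (x i) z)"
  by (induction A rule: infinite_finite_induct) (auto simp: re_ip_zero_left re_ip_add_left)

lemma re_ip_sum_right: "re_ip z (sum x A) = (\<Sum>i\<in>A. re_ip z (x i))"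
  by (simp add: re_ip_sym[of z] re_ip_sum_left)

lemma ip_norm_nonneg: "0 \<le> ip_norm ip x"
  by (simp add: ip_norm_def ip_nonneg)

lemma ip_norm_power2: "(ip_norm ip x)\<^sup>2 = re_ip x x"
  by (simp add: ip_norm_def re_ip_def ip_nonneg)

text \<open>Definiteness speaks of \<open>ip x x\<close> as a scalar, the norm only of its real part; conjugate symmetry
  makes \<open>ip x x\<close> real, so nothing is lost.\<close>

lemma ip_norm_pos:
  assumes "x \<noteq> 0"
  shows "0 < ip_norm ip x"
proof -
  have "re_ip x x \<noteq> 0"
  proof
    assume "re_ip x x = 0"
    moreover have "Im (to_complex (ip x x)) = 0"
      using arg_cong[OF ip_conj_sym[of x x], of Im] by simp
    ultimately have "to_complex (ip x x) = to_complex 0"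
      by (simp add: re_ip_def to_complex_zero complex_eq_iff)
    then have "ip x x = 0"
      by (rule inj_to_complex)
    with assms show False
      using ip_definite by blast
  qed
  then have "ip_norm ip x \<noteq> 0"
    using ip_norm_power2[of x] by auto
  with ip_norm_nonneg[of x] show ?thesis by linarith
qed

text \<open>Only one vector is normalised in the hypothesis. The length of the other one is free, and the
  arithmetic-geometric mean inequality \<open>2 s \<parallel>x\<parallel> \<le> \<parallel>x\<parallel>\<^sup>2 + s\<^sup>2\<close> absorbs it.\<close>

lemma reverse_Schwarz:
  assumes "y \<noteq> 0" and "\<bar>\<rho>\<bar> \<le> 1"
    and close: "ip_norm ip (x - scale (of_real (1 / ip_norm ip y)) y) \<le> \<rho>"
  shows "sqrt (1 - \<rho>\<^sup>2) * (ip_norm ip x * ip_norm ip y) \<le> re_ip x y"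
proof -
  define a b s where "a = ip_norm ip x" and "b = ip_norm ip y" and "s = sqrt (1 - \<rho>\<^sup>2)"
  have b: "0 < b"
    unfolding b_def by (rule ip_norm_pos) fact
  have s: "s\<^sup>2 = 1 - \<rho>\<^sup>2"
    using \<open>\<bar>\<rho>\<bar> \<le> 1\<close> by (simp add: s_def abs_square_le_1)
  have "(ip_norm ip (x - scale (of_real (1 / b)) y))\<^sup>2
      = a\<^sup>2 - 2 * re_ip x y / b + (1 / b) * ((1 / b) * b\<^sup>2)"
    unfolding ip_norm_power2 re_ip_diff_left re_ip_diff_right re_ip_scale_left re_ip_scale_right
      a_def b_def re_ip_sym[of y x]
    by (simp add: diff_divide_distrib)
  also have "\<dots> = a\<^sup>2 - 2 * re_ip x y / b + 1"
    using b by (simp add: power2_eq_square)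
  finally have "a\<^sup>2 - 2 * re_ip x y / b + 1 \<le> \<rho>\<^sup>2"
    using power_mono[OF close ip_norm_nonneg, of 2] by (simp add: b_def)
  moreover have "0 \<le> (a - s)\<^sup>2" by simp
  ultimately have "2 * (s * a) \<le> 2 * re_ip x y / b"
    using s by (simp add: power2_diff algebra_simps)
  then have "s * a \<le> re_ip x y / b" by simp
  with b have "s * a * b \<le> re_ip x y"
    by (simp add: pos_le_divide_eq)
  then show ?thesis
    by (simp add: a_def b_def s_def mult.assoc)
qed

text \<open>Splitting off the diagonal of the defect matrix, where \<open>Re \<langle>x\<^sub>i, x\<^sub>i\<rangle> = \<parallel>x\<^sub>i\<parallel>\<^sup>2\<close>, produces the term with
  the coefficient \<open>1 - s\<close>. What remains is a sum over pairs, so both the inequality and its equality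
  case reduce to a single pair.\<close>

lemma ip_norm_sum_excess:
  fixes x :: "nat \<Rightarrow> 'v"
  shows "(ip_norm ip (\<Sum>i=1..n. x i))\<^sup>2
     - (s * (\<Sum>i=1..n. ip_norm ip (x i))\<^sup>2 + (1 - s) * (\<Sum>i=1..n. (ip_norm ip (x i))\<^sup>2))
   = 2 * (\<Sum>j=1..n. \<Sum>i\<in>{1..<j}. re_ip (x i) (x j) - s * (ip_norm ip (x i) * ip_norm ip (x j)))"
proof -
  define f where "f i j = re_ip (x i) (x j) - s * (ip_norm ip (x i) * ip_norm ip (x j))" for i j
  have sym: "f i j = f j i" for i j
    by (simp add: f_def re_ip_sym[of "x i"] mult.commute)
  have "(ip_norm ip (\<Sum>i=1..n. x i))\<^sup>2 = (\<Sum>i=1..n. \<Sum>j=1..n. re_ip (x i) (x j))"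
    unfolding ip_norm_power2 re_ip_sum_left by (rule sum.cong[OF refl], rule re_ip_sum_right)
  then have "(\<Sum>i=1..n. \<Sum>j=1..n. f i j)
      = (ip_norm ip (\<Sum>i=1..n. x i))\<^sup>2 - s * (\<Sum>i=1..n. ip_norm ip (x i))\<^sup>2"
    by (simp add: f_def power2_eq_square[of "sum _ _"] sum_product sum_subtractf
        sum_distrib_left[symmetric])
  moreover have "(\<Sum>i=1..n. f i i) = (1 - s) * (\<Sum>i=1..n. (ip_norm ip (x i))\<^sup>2)"
    unfolding f_def ip_norm_power2[symmetric] power2_eq_square
    by (simp add: sum_distrib_left algebra_simps)
  ultimately show ?thesis
    using sum_symmetric_square[of f n, OF sym] unfolding f_def by linarith
qed

end

theorem theorem6:
  fixes scale :: "'k::real_or_complex_field \<Rightarrow> 'v::ab_group_add \<Rightarrow> 'v"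
    and ip :: "'v \<Rightarrow> 'v \<Rightarrow> 'k"
    and x :: "nat \<Rightarrow> 'v" and n :: nat and \<rho> :: real
  assumes "inner_product_space scale ip"
    and "n \<ge> 1"
    and "\<forall>i\<in>{1..n}. x i \<noteq> 0"
    and "0 < \<rho>" and "\<rho> < 1"
    and "\<forall>i j. 1 \<le> i \<and> i < j \<and> j \<le> n \<longrightarrow>
           ip_norm ip (x i - scale (of_real (1 / ip_norm ip (x j))) (x j)) \<le> \<rho>"
  shows "sqrt (1 - \<rho>\<^sup>2) * (\<Sum>i=1..n. ip_norm ip (x i))\<^sup>2
           + (1 - sqrt (1 - \<rho>\<^sup>2)) * (\<Sum>i=1..n. (ip_norm ip (x i))\<^sup>2)
         \<le> (ip_norm ip (\<Sum>i=1..n. x i))\<^sup>2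
       \<and> (sqrt (1 - \<rho>\<^sup>2) * (\<Sum>i=1..n. ip_norm ip (x i))\<^sup>2
           + (1 - sqrt (1 - \<rho>\<^sup>2)) * (\<Sum>i=1..n. (ip_norm ip (x i))\<^sup>2)
         = (ip_norm ip (\<Sum>i=1..n. x i))\<^sup>2
         \<longleftrightarrow> (\<forall>i j. 1 \<le> i \<and> i < j \<and> j \<le> n \<longrightarrow>
                ip_norm ip (x i) * ip_norm ip (x j)
                  = 1 / sqrt (1 - \<rho>\<^sup>2) * Re (to_complex (ip (x i) (x j)))))"
proof -
  interpret inner_product_space scale ip by fact
  define s where "s = sqrt (1 - \<rho>\<^sup>2)"
  have "\<rho>\<^sup>2 < 1"
    using assms(4,5) by (simp add: abs_square_less_1)
  then have s: "0 < s" by (simp add: s_def)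
  define f where "f i j = re_ip (x i) (x j) - s * (ip_norm ip (x i) * ip_norm ip (x j))" for i j
  have nonneg: "0 \<le> f i j" if "j \<in> {1..n}" "i \<in> {1..<j}" for i j
    using reverse_Schwarz[of "x j" \<rho> "x i"] assms(3-6) that by (auto simp: f_def s_def)
  have inner: "0 \<le> (\<Sum>i\<in>{1..<j}. f i j)" if "j \<in> {1..n}" for j
    by (rule sum_nonneg) (use nonneg that in blast)
  have sum0: "0 \<le> (\<Sum>j=1..n. \<Sum>i\<in>{1..<j}. f i j)"
    by (rule sum_nonneg) (rule inner)
  have "(\<Sum>j=1..n. \<Sum>i\<in>{1..<j}. f i j) = 0 \<longleftrightarrow> (\<forall>j\<in>{1..n}. (\<Sum>i\<in>{1..<j}. f i j) = 0)"
    by (rule sum_nonneg_eq_0_iff) (use inner in auto)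
  also have "\<dots> \<longleftrightarrow> (\<forall>j\<in>{1..n}. \<forall>i\<in>{1..<j}. f i j = 0)"
    by (intro ball_cong refl sum_nonneg_eq_0_iff) (use nonneg in auto)
  also have "\<dots> \<longleftrightarrow> (\<forall>i j. 1 \<le> i \<and> i < j \<and> j \<le> n \<longrightarrow> f i j = 0)"
    by auto
  also have "\<dots> \<longleftrightarrow> (\<forall>i j. 1 \<le> i \<and> i < j \<and> j \<le> n \<longrightarrow>
      ip_norm ip (x i) * ip_norm ip (x j) = 1 / s * Re (to_complex (ip (x i) (x j))))"
  proof -
    have "f i j = 0 \<longleftrightarrow>
        ip_norm ip (x i) * ip_norm ip (x j) = 1 / s * Re (to_complex (ip (x i) (x j)))" for i j
      using s by (auto simp: f_def re_ip_def field_simps)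
    then show ?thesis by simp
  qed
  finally have zero_iff: "(\<Sum>j=1..n. \<Sum>i\<in>{1..<j}. f i j) = 0 \<longleftrightarrow>
      (\<forall>i j. 1 \<le> i \<and> i < j \<and> j \<le> n \<longrightarrow>
        ip_norm ip (x i) * ip_norm ip (x j) = 1 / s * Re (to_complex (ip (x i) (x j))))" .
  have excess: "(ip_norm ip (\<Sum>i=1..n. x i))\<^sup>2
      - (s * (\<Sum>i=1..n. ip_norm ip (x i))\<^sup>2 + (1 - s) * (\<Sum>i=1..n. (ip_norm ip (x i))\<^sup>2))
      = 2 * (\<Sum>j=1..n. \<Sum>i\<in>{1..<j}. f i j)"
    unfolding f_def by (rule ip_norm_sum_excess)
  show ?thesis
    unfolding s_def[symmetric] zero_iff[symmetric]
    using excess sum0 by linarith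
qed

end
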